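(* Let $\hbar>0$. For constants $\alpha,\beta,\gamma>0$ and $u>1$, let $G_0^{(\alpha,\beta)}(u)$ and $G_2^{(\alpha,\beta)}(u)$ be the minima of $$F_{\alpha,\beta,\gamma}(K)^2=\tfrac14\left[\alpha\operatorname{Tr}(A^{\mathsf T}A)+2\beta\operatorname{Tr}(B^{\mathsf T}B)+\gamma\operatorname{Tr}(D^{\mathsf T}D)\right]$$ over all $K\in\mathfrak{sp}(4,\mathbb R)$ with blocks $A,B,D$ that induce, at the canonical purification of $\nu\mathbb I_2$ with $\nu=\hbar\sqrt u/2$, the reduced tangent $\mathbb I_2$, respectively $Z$. Let $R_{\rm B}(u)=\frac{u+1}{u-1}$ be the Bures radial-to-traceless squared-cost ratio. Then: (i) there are no constants $\alpha,\beta,\gamma>0$ (independent of $u$) such that $G_0^{(\alpha,\beta)}(u)/G_2^{(\alpha,\beta)}(u)=R_{\rm B}(u)$ for all $u>1$; (ii) if $G_0^{(\alpha,\beta)}(u)/G_2^{(\alpha,\beta)}(u)=R_{\rm B}(u)$ at a specified $u>1$, then $\beta/\alpha=1/u$.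
   Context: Let $\Omega=\begin{pmatrix}0&1\\-1&0\end{pmatrix}$, $Z=\begin{pmatrix}1&0\\0&-1\end{pmatrix}$, $\kappa_\nu=\sqrt{\nu^2-\hbar^2/4}$; here $\nu>\hbar/2$ and $u=(2\nu/\hbar)^2$. The canonical purification of the one-mode covariance $\nu\mathbb I_2$ has covariance $\Gamma_\nu=\begin{pmatrix}\nu\mathbb I_2&\kappa_\nu Z\\ \kappa_\nu Z&\nu\mathbb I_2\end{pmatrix}$. With symplectic form $\Omega\oplus\Omega$, every $K\in\mathfrak{sp}(4,\mathbb R)$ has the block form $$K=\begin{pmatrix}A&B\\ \Omega B^{\mathsf T}\Omega&D\end{pmatrix},\qquad A,D\in\mathfrak{sp}(2,\mathbb R)\ (\text{real traceless } 2\times2),\quad B\in\mathbb R^{2\times2}\text{ arbitrary}.$$ $K$ induces the reduced tangent $X$ (a real symmetric $2\times2$ matrix) if the upper-left (system) $2\times2$ block of $K\Gamma_\nu+\Gamma_\nu K^{\mathsf T}$ equals $X$, i.e. $X=\nu(A+A^{\mathsf T})+\kappa_\nu(BZ+ZB^{\mathsf T})$. The faithful isotropic family is the set of covariances $\nu\mathbb I_2$ with $\nu>\hbar/2$, i.e. $u>1$. The Bures ratio $R_{\rm B}(u)$ is the ratio $g_{\rm B}(\mathbb I_2,\mathbb I_2)/g_{\rm B}(Z,Z)$ of the Gaussian Bures metric at $\nu\mathbb I_2$. *)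

theory Defs
  imports "HOL-Analysis.Analysis"
begin

text \<open>
  The two-mode phase space is indexed by \<open>2 + 2\<close>: \<open>Inl\<close> is the system mode and
  \<open>Inr\<close> the purifying mode.
\<close>

type_synonym mat2 = "real^2^2"
type_synonym mat22 = "real^(2 + 2)^(2 + 2)"

definition blocks :: "mat2 \<Rightarrow> mat2 \<Rightarrow> mat2 \<Rightarrow> mat2 \<Rightarrow> mat22" where
  "blocks A B C D = (\<chi> i j.
     case i of
       Inl i' \<Rightarrow> (case j of Inl j' \<Rightarrow> A $ i' $ j' | Inr j' \<Rightarrow> B $ i' $ j')
     | Inr i' \<Rightarrow> (case j of Inl j' \<Rightarrow> C $ i' $ j' | Inr j' \<Rightarrow> D $ i' $ j'))"

definition block_A :: "mat22 \<Rightarrow> mat2" where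
  "block_A K = (\<chi> i j. K $ Inl i $ Inl j)"

definition block_B :: "mat22 \<Rightarrow> mat2" where
  "block_B K = (\<chi> i j. K $ Inl i $ Inr j)"

definition block_D :: "mat22 \<Rightarrow> mat2" where
  "block_D K = (\<chi> i j. K $ Inr i $ Inr j)"

definition \<Omega> :: mat2 where
  "\<Omega> = vector [vector [0, 1], vector [-1, 0]]"

definition Z :: mat2 where
  "Z = vector [vector [1, 0], vector [0, -1]]"

text \<open>
  The Lie algebra of the group of \<open>S\<close> with \<open>S J S\<^sup>T = J\<close>, where \<open>J = \<Omega> \<oplus> \<Omega>\<close>; these \<open>S\<close>
  act on covariances by \<open>\<Gamma> \<mapsto> S \<Gamma> S\<^sup>T\<close>. Since \<open>J\<^sup>2 = -1\<close>, the condition is equivalent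
  to \<open>K\<^sup>T J + J K = 0\<close>; it forces the lower-left block of \<open>K\<close> to be \<open>\<Omega> B\<^sup>T \<Omega>\<close>.
\<close>

definition sp4 :: "mat22 set" where
  "sp4 = {K. K ** blocks \<Omega> 0 0 \<Omega> + blocks \<Omega> 0 0 \<Omega> ** transpose K = 0}"

definition kappa :: "real \<Rightarrow> real \<Rightarrow> real" where
  "kappa hbar \<nu> = sqrt (\<nu>\<^sup>2 - hbar\<^sup>2 / 4)"

definition purification_cov :: "real \<Rightarrow> real \<Rightarrow> mat22" where
  "purification_cov hbar \<nu> =
     blocks (\<nu> *\<^sub>R mat 1) (kappa hbar \<nu> *\<^sub>R Z)
            (kappa hbar \<nu> *\<^sub>R Z) (\<nu> *\<^sub>R mat 1)"

definition induces :: "real \<Rightarrow> real \<Rightarrow> mat22 \<Rightarrow> mat2 \<Rightarrow> bool" where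
  "induces hbar \<nu> K X \<longleftrightarrow>
     block_A (K ** purification_cov hbar \<nu> + purification_cov hbar \<nu> ** transpose K) = X"

definition cost_sq :: "real \<Rightarrow> real \<Rightarrow> real \<Rightarrow> mat22 \<Rightarrow> real" where
  "cost_sq \<alpha> \<beta> \<gamma> K =
     (\<alpha> * trace (transpose (block_A K) ** block_A K)
      + 2 * \<beta> * trace (transpose (block_B K) ** block_B K)
      + \<gamma> * trace (transpose (block_D K) ** block_D K)) / 4"

text \<open>
  \<open>LEAST\<close> on the reals is the attained minimum, not merely the infimum; its value is
  unspecified if no minimum exists.
\<close>

definition min_cost_sq :: "real \<Rightarrow> real \<Rightarrow> real \<Rightarrow> real \<Rightarrow> mat2 \<Rightarrow> real \<Rightarrow> real" where
  "min_cost_sq hbar \<alpha> \<beta> \<gamma> X u =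
     (LEAST c. \<exists>K \<in> sp4. induces hbar (hbar * sqrt u / 2) K X \<and> c = cost_sq \<alpha> \<beta> \<gamma> K)"

definition G0 :: "real \<Rightarrow> real \<Rightarrow> real \<Rightarrow> real \<Rightarrow> real \<Rightarrow> real" where
  "G0 hbar \<alpha> \<beta> \<gamma> u = min_cost_sq hbar \<alpha> \<beta> \<gamma> (mat 1) u"

definition G2 :: "real \<Rightarrow> real \<Rightarrow> real \<Rightarrow> real \<Rightarrow> real \<Rightarrow> real" where
  "G2 hbar \<alpha> \<beta> \<gamma> u = min_cost_sq hbar \<alpha> \<beta> \<gamma> Z u"

definition bures_ratio :: "real \<Rightarrow> real" where
  "bures_ratio u = (u + 1) / (u - 1)"

end

theory Submission
  imports Defs
begin

text \<open>
  Only the entries of \<open>A\<close> and \<open>B\<close> enter the constraint. For the radial tangent the constraint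
  forces the diagonal of \<open>B\<close> to carry all of it, so \<open>A = 0\<close> is optimal and the minimum is
  \<open>\<beta> / (4 \<kappa>\<^sup>2)\<close>. For the traceless tangent \<open>A\<close> and \<open>B\<close> share the load, and weighted
  Cauchy--Schwarz gives \<open>\<alpha> \<beta> / (4 (2 \<nu>\<^sup>2 \<beta> + \<kappa>\<^sup>2 \<alpha>))\<close>. Since \<open>\<nu>\<^sup>2 / \<kappa>\<^sup>2 = u / (u - 1)\<close>, the ratio
  is \<open>1 + 2 u \<beta> / ((u - 1) \<alpha>)\<close>, whereas the Bures ratio is \<open>1 + 2 / (u - 1)\<close>. They agree exactly
  when \<open>\<beta> / \<alpha> = 1 / u\<close>, which cannot hold at two values of \<open>u\<close>.
\<close>

section \<open>Block calculus for matrices indexed by a sum type\<close>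

lemma sum_UNIV_Plus:
  fixes f :: "'a::finite + 'b::finite \<Rightarrow> 'c::comm_monoid_add"
  shows "sum f UNIV = (\<Sum>i\<in>UNIV. f (Inl i)) + (\<Sum>j\<in>UNIV. f (Inr j))"
  by (simp add: UNIV_Plus_UNIV[symmetric] sum.Plus del: UNIV_Plus_UNIV)

lemma forall_Plus: "(\<forall>x::'a + 'b. P x) \<longleftrightarrow> (\<forall>i. P (Inl i)) \<and> (\<forall>j. P (Inr j))"
  by (metis sum.exhaust)

lemma blocks_eq_iff:
  "blocks A B C D = blocks A' B' C' D' \<longleftrightarrow> A = A' \<and> B = B' \<and> C = C' \<and> D = D'"
  unfolding blocks_def vec_eq_iff forall_Plus by auto

lemma blocks_mult:
  "blocks A B C D ** blocks A' B' C' D' =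
     blocks (A ** A' + B ** C') (A ** B' + B ** D') (C ** A' + D ** C') (C ** B' + D ** D')"
  unfolding blocks_def vec_eq_iff forall_Plus
  by (simp add: matrix_matrix_mult_def sum_UNIV_Plus)

lemma blocks_add:
  "blocks A B C D + blocks A' B' C' D' = blocks (A + A') (B + B') (C + C') (D + D')"
  unfolding blocks_def vec_eq_iff forall_Plus by simp

lemma blocks_zero: "blocks 0 0 0 0 = 0"
  unfolding blocks_def vec_eq_iff forall_Plus by simp

lemma transpose_blocks:
  "transpose (blocks A B C D) = blocks (transpose A) (transpose C) (transpose B) (transpose D)"
  unfolding blocks_def vec_eq_iff forall_Plus by (simp add: transpose_def)

lemma block_A_blocks [simp]: "block_A (blocks A B C D) = A"
  and block_B_blocks [simp]: "block_B (blocks A B C D) = B"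
  and block_D_blocks [simp]: "block_D (blocks A B C D) = D"
  by (simp_all add: block_A_def block_B_def block_D_def blocks_def)

lemma blocks_exhaust:
  fixes K :: mat22
  obtains A B C D where "K = blocks A B C D"
proof
  show "K = blocks (\<chi> i j. K $ Inl i $ Inl j) (\<chi> i j. K $ Inl i $ Inr j)
                   (\<chi> i j. K $ Inr i $ Inl j) (\<chi> i j. K $ Inr i $ Inr j)"
    unfolding blocks_def vec_eq_iff forall_Plus by simp
qed

section \<open>Block coordinates on \<open>sp4\<close> and reduction to the blocks \<open>A\<close>
  and \<open>B\<close>\<close>

lemmas mat2_simps =
  vec_eq_iff forall_2 matrix_matrix_mult_def sum_2 transpose_def trace_def \<Omega>_def Z_def
  vector_2 mat_def

text \<open>For every 2x2 matrix \<open>M\<close>,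
  \<open>M ** \<Omega> + \<Omega> ** transpose M\<close> equals
  \<open>trace M *\<^sub>R \<Omega>\<close>, which settles the diagonal blocks. The two off-diagonal
  equations are negative transposes of each other; solving one for \<open>C\<close> uses that
  \<open>\<Omega>\<close> squares to minus the identity.\<close>

lemma blocks_mem_sp4_iff:
  "blocks A B C D \<in> sp4 \<longleftrightarrow>
     trace A = 0 \<and> trace D = 0 \<and> C = \<Omega> ** transpose B ** \<Omega>"
proof -
  have "blocks A B C D \<in> sp4 \<longleftrightarrow>
      A ** \<Omega> + \<Omega> ** transpose A = 0 \<and> B ** \<Omega> + \<Omega> ** transpose C = 0 \<and>
      C ** \<Omega> + \<Omega> ** transpose B = 0 \<and> D ** \<Omega> + \<Omega> ** transpose D = 0"
    by (simp add: sp4_def transpose_blocks blocks_mult blocks_add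
          blocks_eq_iff flip: blocks_zero)
  also have "\<dots> \<longleftrightarrow> trace A = 0 \<and> trace D = 0 \<and> C = \<Omega> ** transpose B ** \<Omega>"
    by (simp add: mat2_simps) argo
  finally show ?thesis .
qed

lemma induces_blocks_iff:
  "induces hbar \<nu> (blocks A B C D) X \<longleftrightarrow>
     \<nu> *\<^sub>R (A + transpose A) + kappa hbar \<nu> *\<^sub>R (B ** Z + Z ** transpose B) = X"
  unfolding induces_def purification_cov_def transpose_blocks blocks_mult blocks_add block_A_blocks
  by (simp add: mat2_simps algebra_simps)

lemma trace_transpose_mult:
  fixes A :: mat2
  shows "trace (transpose A ** A) = (A$1$1)\<^sup>2 + (A$1$2)\<^sup>2 + (A$2$1)\<^sup>2 + (A$2$2)\<^sup>2"
  by (simp add: mat2_simps power2_eq_square)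

text \<open>Since \<open>D\<close> is absent from the constraint and adds a nonnegative cost, it may
  be set to zero, while \<open>C\<close> is determined by \<open>B\<close>. What remains is a
  minimization over \<open>A\<close> and \<open>B\<close>; writing \<open>4 * c\<close> clears the
  factor 1/4 of the cost.\<close>

lemma min_cost_sq_eqI:
  fixes hbar u :: real
  defines "\<nu> \<equiv> hbar * sqrt u / 2"
  assumes feasible: "trace A = 0" "\<nu> *\<^sub>R (A + transpose A) +
             kappa hbar \<nu> *\<^sub>R (B ** Z + Z ** transpose B) = X"
    and cost: "\<alpha> * trace (transpose A ** A) + 2 * \<beta> * trace (transpose B ** B) = 4 * c"
    and lower: "\<And>A B. trace A = 0 \<Longrightarrow>
           \<nu> *\<^sub>R (A + transpose A) + kappa hbar \<nu> *\<^sub>R (B ** Z + Z ** transpose B) = X \<Longrightarrow>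
           4 * c \<le> \<alpha> * trace (transpose A ** A) + 2 * \<beta> * trace (transpose B ** B)"
    and "\<gamma> \<ge> 0"
  shows "min_cost_sq hbar \<alpha> \<beta> \<gamma> X u = c"
  unfolding min_cost_sq_def \<nu>_def[symmetric]
proof (rule Least_equality)
  let ?K = "blocks A B (\<Omega> ** transpose B ** \<Omega>) 0"
  have "?K \<in> sp4"
    using feasible by (simp add: blocks_mem_sp4_iff trace_def)
  moreover have "induces hbar \<nu> ?K X"
    using feasible by (simp add: induces_blocks_iff)
  moreover have "c = cost_sq \<alpha> \<beta> \<gamma> ?K"
    using cost by (simp add: cost_sq_def trace_def)
  ultimately show "\<exists>K\<in>sp4. induces hbar \<nu> K X \<and> c = cost_sq \<alpha> \<beta> \<gamma> K"
    by blast
next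
  fix y
  assume "\<exists>K\<in>sp4. induces hbar \<nu> K X \<and> y = cost_sq \<alpha> \<beta> \<gamma> K"
  then obtain K where K: "K \<in> sp4" "induces hbar \<nu> K X" "y = cost_sq \<alpha> \<beta> \<gamma> K"
    by blast
  obtain A B C D where blocks: "K = blocks A B C D"
    by (rule blocks_exhaust)
  have "4 * c \<le> \<alpha> * trace (transpose A ** A) + 2 * \<beta> * trace (transpose B ** B)"
    using K by (intro lower) (auto simp: blocks blocks_mem_sp4_iff induces_blocks_iff)
  moreover have "0 \<le> \<gamma> * trace (transpose D ** D)"
    using \<open>\<gamma> \<ge> 0\<close> by (simp add: trace_transpose_mult)
  ultimately show "c \<le> y"
    by (simp add: K blocks cost_sq_def)
qed

section \<open>Minimum for the radial tangent\<close>

lemma kappa_sq: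
  assumes "u > 1"
  shows "(kappa hbar (hbar * sqrt u / 2))\<^sup>2 = hbar\<^sup>2 * (u - 1) / 4"
proof -
  have "(hbar * sqrt u / 2)\<^sup>2 - hbar\<^sup>2 / 4 = hbar\<^sup>2 * (u - 1) / 4"
    using assms by (simp add: power_mult_distrib power_divide field_simps)
  then show ?thesis
    using assms by (simp only: kappa_def) simp
qed

lemma G0_eq:
  assumes "hbar > 0" "u > 1" "\<alpha> > 0" "\<beta> > 0" "\<gamma> > 0"
  shows "G0 hbar \<alpha> \<beta> \<gamma> u = \<beta> / (hbar\<^sup>2 * (u - 1))"
  unfolding G0_def
proof (rule min_cost_sq_eqI)
  define \<nu> where "\<nu> = hbar * sqrt u / 2"
  define \<kappa> where "\<kappa> = kappa hbar \<nu>"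
  have \<kappa>_sq: "\<kappa>\<^sup>2 = hbar\<^sup>2 * (u - 1) / 4"
    using kappa_sq[OF \<open>u > 1\<close>] by (simp add: \<kappa>_def \<nu>_def)
  then have "\<kappa> \<noteq> 0"
    using assms by auto
  have cost_eq: "4 * (\<beta> / (hbar\<^sup>2 * (u - 1))) = \<beta> / \<kappa>\<^sup>2"
    using assms by (simp add: \<kappa>_sq)
  \<comment> \<open>The minimizer is \<open>A = 0\<close>,
    \<open>B = (1 / (2 * \<kappa>)) *\<^sub>R Z\<close>; it is feasible because
    \<open>Z ** Z = mat 1\<close>.\<close>
  show "trace (0::mat2) = 0"
    by (simp add: trace_def)
  show "(hbar * sqrt u / 2) *\<^sub>R (0 + transpose 0) + kappa hbar (hbar * sqrt u / 2) *\<^sub>R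
      ((1 / (2 * \<kappa>)) *\<^sub>R Z ** Z + Z ** transpose ((1 / (2 * \<kappa>)) *\<^sub>R Z)) = mat 1"
    using \<open>\<kappa> \<noteq> 0\<close> by (simp add: mat2_simps flip: \<nu>_def \<kappa>_def)
  show "\<alpha> * trace (transpose 0 ** (0::mat2)) + 2 * \<beta> *
      trace (transpose ((1 / (2 * \<kappa>)) *\<^sub>R Z) ** (1 / (2 * \<kappa>)) *\<^sub>R Z) =
      4 * (\<beta> / (hbar\<^sup>2 * (u - 1)))"
    unfolding cost_eq using \<open>\<kappa> \<noteq> 0\<close>
    by (simp add: mat2_simps power2_eq_square field_simps)
  show "\<gamma> \<ge> 0"
    using assms by simp
  fix A B :: mat2
  assume "trace A = 0" and "(hbar * sqrt u / 2) *\<^sub>R (A + transpose A) +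
      kappa hbar (hbar * sqrt u / 2) *\<^sub>R (B ** Z + Z ** transpose B) = mat 1"
  \<comment> \<open>Adding the two diagonal entries of the constraint eliminates \<open>A\<close>,
    which is traceless.\<close>
  then have "\<kappa> * (B$1$1 - B$2$2) = 1"
    unfolding \<nu>_def[symmetric] \<kappa>_def[symmetric]
    by (simp add: mat2_simps algebra_simps add_eq_0_iff)
  then have "1 / \<kappa>\<^sup>2 = (B$1$1 - B$2$2)\<^sup>2"
    using \<open>\<kappa> \<noteq> 0\<close> by (simp add: field_simps flip: power_mult_distrib)
  also have "\<dots> \<le> 2 * ((B$1$1)\<^sup>2 + (B$2$2)\<^sup>2)"
    using zero_le_power2[of "B$1$1 + B$2$2"] by (simp add: power2_sum power2_diff)
  also have "\<dots> \<le> 2 * trace (transpose B ** B)"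
    by (simp add: trace_transpose_mult)
  finally have "\<beta> * (1 / \<kappa>\<^sup>2) \<le> \<beta> * (2 * trace (transpose B ** B))"
    using assms by (intro mult_left_mono) auto
  moreover have "0 \<le> \<alpha> * trace (transpose A ** A)"
    using assms by (simp add: trace_transpose_mult)
  ultimately show "4 * (\<beta> / (hbar\<^sup>2 * (u - 1))) \<le>
      \<alpha> * trace (transpose A ** A) + 2 * \<beta> * trace (transpose B ** B)"
    unfolding cost_eq by simp
qed

section \<open>Minimum for the traceless tangent\<close>

lemma weighted_Cauchy_Schwarz:
  fixes p q v w x y :: real
  assumes "p > 0" "q > 0"
  shows "(v * x + w * y)\<^sup>2 / (v\<^sup>2 / p + w\<^sup>2 / q) \<le> p * x\<^sup>2 + q * y\<^sup>2"
proof (cases "v\<^sup>2 / p + w\<^sup>2 / q = 0")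
  \<comment> \<open>Division by zero gives 0, so only nonnegativity of the right-hand side is
    claimed.\<close>
  case True
  then show ?thesis
    using assms by simp
next
  case False
  moreover have "0 \<le> v\<^sup>2 / p + w\<^sup>2 / q"
    using assms by simp
  ultimately have pos: "0 < v\<^sup>2 / p + w\<^sup>2 / q"
    by linarith
  have "(p * x\<^sup>2 + q * y\<^sup>2) * (v\<^sup>2 / p + w\<^sup>2 / q) - (v * x + w * y)\<^sup>2
      = (p * w * x - q * v * y)\<^sup>2 / (p * q)"
    using assms by (simp add: field_simps power2_eq_square)
  also have "\<dots> \<ge> 0"
    using assms by simp
  finally show ?thesis
    using pos by (simp add: divide_le_eq)
qed

lemma G2_eq:
  assumes "hbar > 0" "u > 1" "\<alpha> > 0" "\<beta> > 0" "\<gamma> > 0"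
  shows "G2 hbar \<alpha> \<beta> \<gamma> u = \<alpha> * \<beta> / (hbar\<^sup>2 * (2 * u * \<beta> + (u - 1) * \<alpha>))"
  unfolding G2_def
proof (rule min_cost_sq_eqI)
  define \<nu> where "\<nu> = hbar * sqrt u / 2"
  define \<kappa> where "\<kappa> = kappa hbar \<nu>"
  have \<kappa>_sq: "\<kappa>\<^sup>2 = hbar\<^sup>2 * (u - 1) / 4"
    using kappa_sq[OF \<open>u > 1\<close>] by (simp add: \<kappa>_def \<nu>_def)
  have \<nu>_sq: "\<nu>\<^sup>2 = hbar\<^sup>2 * u / 4"
    using assms by (simp add: \<nu>_def power_mult_distrib power_divide)
  \<comment> \<open>The Cauchy-Schwarz denominator for the weights \<open>2 * \<alpha>\<close> and
    \<open>4 * \<beta>\<close>, which arise because \<open>a *\<^sub>R Z\<close> and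
    \<open>b *\<^sub>R mat 1\<close> each have two diagonal entries of equal square.\<close>
  define N where "N = (2 * \<nu>)\<^sup>2 / (2 * \<alpha>) + (2 * \<kappa>)\<^sup>2 / (4 * \<beta>)"
  have "\<nu>\<^sup>2 > 0" "\<kappa>\<^sup>2 > 0"
    using assms by (simp_all add: \<nu>_sq \<kappa>_sq)
  then have "N > 0"
    using assms unfolding N_def by (intro add_pos_pos divide_pos_pos) auto
  have "2 * u * \<beta> + (u - 1) * \<alpha> > 0"
    using assms by (intro add_pos_pos mult_pos_pos) auto
  then have cost_eq: "4 * (\<alpha> * \<beta> / (hbar\<^sup>2 * (2 * u * \<beta> + (u - 1) * \<alpha>))) = 1 / N"
    using assms \<open>N > 0\<close> unfolding N_def
    by (simp add: power_mult_distrib \<nu>_sq \<kappa>_sq) (simp add: field_simps)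
  txt \<open>The Lagrange point of \<open>2 \<alpha> a\<^sup>2 + 4 \<beta> b\<^sup>2\<close> on the line \<open>2 \<nu> a + 2 \<kappa> b = 1\<close>.\<close>
  define a b where "a = \<nu> / (\<alpha> * N)" and "b = \<kappa> / (2 * \<beta> * N)"
  have "(2 * \<nu> * a + 2 * \<kappa> * b) * N = N"
    using assms \<open>N > 0\<close> unfolding a_def b_def
    by (simp add: field_simps) (simp add: N_def field_simps power2_eq_square)
  then have constraint: "2 * \<nu> * a + 2 * \<kappa> * b = 1"
    using \<open>N > 0\<close> by simp
  \<comment> \<open>Stationarity reads \<open>2 * \<alpha> * a = 2 * \<nu> / N\<close> and
    \<open>4 * \<beta> * b = 2 * \<kappa> / N\<close>; multiply by \<open>a\<close> and
    \<open>b\<close> and add.\<close>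
  have "(2 * \<alpha> * a\<^sup>2 + 4 * \<beta> * b\<^sup>2) * N = 2 * \<nu> * a + 2 * \<kappa> * b"
    using assms \<open>N > 0\<close> unfolding a_def b_def
    by (simp add: field_simps power2_eq_square)
  then have cost: "2 * \<alpha> * a\<^sup>2 + 4 * \<beta> * b\<^sup>2 = 1 / N"
    using \<open>N > 0\<close> constraint by (simp add: field_simps)
  show "trace (a *\<^sub>R Z) = 0"
    by (simp add: mat2_simps)
  show "(hbar * sqrt u / 2) *\<^sub>R (a *\<^sub>R Z + transpose (a *\<^sub>R Z)) +
      kappa hbar (hbar * sqrt u / 2) *\<^sub>R
        (b *\<^sub>R mat 1 ** Z + Z ** transpose (b *\<^sub>R mat 1)) = Z"
    using constraint unfolding \<nu>_def[symmetric] \<kappa>_def[symmetric]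
    by (simp add: mat2_simps algebra_simps)
  show "\<alpha> * trace (transpose (a *\<^sub>R Z) ** a *\<^sub>R Z) +
      2 * \<beta> * trace (transpose (b *\<^sub>R mat 1) ** b *\<^sub>R (mat 1 :: mat2)) =
      4 * (\<alpha> * \<beta> / (hbar\<^sup>2 * (2 * u * \<beta> + (u - 1) * \<alpha>)))"
    unfolding cost_eq cost[symmetric] trace_transpose_mult
    by (simp add: mat2_simps)
  show "\<gamma> \<ge> 0"
    using assms by simp
  fix A B :: mat2
  assume "trace A = 0" and "(hbar * sqrt u / 2) *\<^sub>R (A + transpose A) +
      kappa hbar (hbar * sqrt u / 2) *\<^sub>R (B ** Z + Z ** transpose B) = Z"
  \<comment> \<open>With trace zero, both diagonal entries of the constraint contain the same
    \<open>A$1$1\<close>. Hence the diagonal of \<open>B\<close> is constant and two unknowns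
    remain.\<close>
  then have A22: "A$2$2 = - A$1$1" and "2 * \<nu> * A$1$1 + 2 * \<kappa> * B$1$1 = 1"
    and "2 * \<nu> * A$1$1 + 2 * \<kappa> * B$2$2 = 1"
    unfolding \<nu>_def[symmetric] \<kappa>_def[symmetric]
    by (simp_all add: mat2_simps algebra_simps add_eq_0_iff)
  moreover have "B$1$1 = B$2$2"
  proof -
    have "2 * \<kappa> * B$1$1 = 2 * \<kappa> * B$2$2"
      using calculation by linarith
    then show ?thesis
      using \<open>\<kappa>\<^sup>2 > 0\<close> by simp
  qed
  ultimately have "1 / N = (2 * \<nu> * A$1$1 + 2 * \<kappa> * B$1$1)\<^sup>2 / N"
    by simp
  also have "\<dots> \<le> 2 * \<alpha> * (A$1$1)\<^sup>2 + 4 * \<beta> * (B$1$1)\<^sup>2"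
    unfolding N_def using assms by (intro weighted_Cauchy_Schwarz) auto
  also have "\<dots> = \<alpha> * ((A$1$1)\<^sup>2 + (A$2$2)\<^sup>2) + 2 * \<beta> * ((B$1$1)\<^sup>2 + (B$2$2)\<^sup>2)"
    by (simp add: A22 \<open>B$1$1 = B$2$2\<close>)
  \<comment> \<open>Off-diagonal entries only add to the cost.\<close>
  also have "\<dots> \<le> \<alpha> * trace (transpose A ** A) + 2 * \<beta> * trace (transpose B ** B)"
    using assms unfolding trace_transpose_mult by (intro add_mono mult_left_mono) auto
  finally show "4 * (\<alpha> * \<beta> / (hbar\<^sup>2 * (2 * u * \<beta> + (u - 1) * \<alpha>))) \<le>
      \<alpha> * trace (transpose A ** A) + 2 * \<beta> * trace (transpose B ** B)"
    unfolding cost_eq .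
qed

section \<open>Comparison with the Bures ratio\<close>

lemma G0_div_G2:
  assumes "hbar > 0" "u > 1" "\<alpha> > 0" "\<beta> > 0" "\<gamma> > 0"
  shows "G0 hbar \<alpha> \<beta> \<gamma> u / G2 hbar \<alpha> \<beta> \<gamma> u = 1 + 2 * u * (\<beta> / \<alpha>) / (u - 1)"
proof -
  have "2 * u * \<beta> + (u - 1) * \<alpha> > 0"
    using assms by (intro add_pos_pos mult_pos_pos) auto
  then show ?thesis
    using assms unfolding G0_eq[OF assms] G2_eq[OF assms] by (simp add: field_simps)
qed

text \<open>This form matches \<open>G0_div_G2\<close> term by term, so equality of the ratios
  becomes \<open>u * (\<beta> / \<alpha>) = 1\<close>.\<close>

lemma bures_ratio_eq:
  assumes "u > 1"
  shows "bures_ratio u = 1 + 2 / (u - 1)"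
  using assms by (simp add: bures_ratio_def field_simps)

lemma bures_ratio_imp_weights:
  assumes "hbar > 0" "u > 1" "\<alpha> > 0" "\<beta> > 0" "\<gamma> > 0"
    and "G0 hbar \<alpha> \<beta> \<gamma> u / G2 hbar \<alpha> \<beta> \<gamma> u = bures_ratio u"
  shows "\<beta> / \<alpha> = 1 / u"
proof -
  have "2 * u * (\<beta> / \<alpha>) / (u - 1) = 2 / (u - 1)"
    using assms(6) G0_div_G2[OF assms(1-5)] bures_ratio_eq[OF assms(2)] by simp
  then have "u * (\<beta> / \<alpha>) = 1"
    using assms(2) unfolding divide_cancel_right by linarith
  then show ?thesis
    using assms(2,3) by (auto simp: field_simps)
qed

theorem theorem6p4:
  fixes hbar :: real
  assumes "hbar > 0"
  shows "\<not> (\<exists>\<alpha> \<beta> \<gamma>. \<alpha> > 0 \<and> \<beta> > 0 \<and> \<gamma> > 0 \<and>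
            (\<forall>u > 1. G0 hbar \<alpha> \<beta> \<gamma> u / G2 hbar \<alpha> \<beta> \<gamma> u = bures_ratio u))
       \<and> (\<forall>\<alpha> \<beta> \<gamma> u. \<alpha> > 0 \<and> \<beta> > 0 \<and> \<gamma> > 0 \<and> u > 1 \<and>
            G0 hbar \<alpha> \<beta> \<gamma> u / G2 hbar \<alpha> \<beta> \<gamma> u = bures_ratio u
          \<longrightarrow> \<beta> / \<alpha> = 1 / u)"
proof (intro conjI notI allI impI)
  fix \<alpha> \<beta> \<gamma> u :: real
  assume "\<alpha> > 0 \<and> \<beta> > 0 \<and> \<gamma> > 0 \<and> u > 1 \<and>
            G0 hbar \<alpha> \<beta> \<gamma> u / G2 hbar \<alpha> \<beta> \<gamma> u = bures_ratio u"
  then show "\<beta> / \<alpha> = 1 / u"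
    using bures_ratio_imp_weights assms by blast
next
  assume "\<exists>\<alpha> \<beta> \<gamma>. \<alpha> > 0 \<and> \<beta> > 0 \<and> \<gamma> > 0 \<and>
            (\<forall>u > 1. G0 hbar \<alpha> \<beta> \<gamma> u / G2 hbar \<alpha> \<beta> \<gamma> u = bures_ratio u)"
  then obtain \<alpha> \<beta> \<gamma> where pos: "\<alpha> > 0" "\<beta> > 0" "\<gamma> > 0"
    and eq: "\<And>u. u > 1 \<Longrightarrow> G0 hbar \<alpha> \<beta> \<gamma> u / G2 hbar \<alpha> \<beta> \<gamma> u = bures_ratio u"
    by blast
  have "\<beta> / \<alpha> = 1 / u" if "u > 1" for u
    by (rule bures_ratio_imp_weights[OF assms that pos eq[OF that]])
  \<comment> \<open>The same quotient would have to be both 1/2 and 1/3.\<close>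
  from this[of 2] this[of 3] show False
    by simp
qed

end
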